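(* Every strongly $\Delta$-clean ring is a $\Delta U$ ring.
   Context: Rings are associative with identity, not necessarily commutative. $U(R)$ is the group of units of $R$. Define $\Delta(R)=\{x\in R \mid 1-xu\in U(R)\text{ for all }u\in U(R)\}$. A ring $R$ is strongly $\Delta$-clean if every $a\in R$ can be written $a=e+d$ with $e^2=e\in R$, $d\in\Delta(R)$ and $ed=de$. A ring $R$ is called $\Delta U$ if $1+\Delta(R)=U(R)$. *)

theory Defs
  imports "HOL-Algebra.Ring"
begin

text \<open>Rings are carrier-based rather than types of class \<open>ring_1\<close>, because that class
  imposes \<open>0 \<noteq> 1\<close> and so excludes the zero ring. \<open>Units R\<close> consists of the two-sided units.\<close>

definition Delta :: "('a, 'b) ring_scheme \<Rightarrow> 'a set" where
  "Delta R = {x \<in> carrier R. \<forall>u\<in>Units R. \<one>\<^bsub>R\<^esub> \<ominus>\<^bsub>R\<^esub> x \<otimes>\<^bsub>R\<^esub> u \<in> Units R}"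

locale strongly_Delta_clean_ring = ring R for R (structure) +
  assumes strongly_Delta_clean:
    "a \<in> carrier R \<Longrightarrow>
      \<exists>e\<in>carrier R. \<exists>d\<in>Delta R. e \<otimes> e = e \<and> a = e \<oplus> d \<and> e \<otimes> d = d \<otimes> e"

locale Delta_U_ring = ring R for R (structure) +
  assumes one_plus_Delta: "(\<lambda>d. \<one> \<oplus> d) ` Delta R = Units R"

end

theory Submission
  imports Defs
begin

text \<open>Subtracting an element of \<open>Delta R\<close> from a unit leaves a unit, because u -
  d = (1 - d u^-1) u. So if a unit u decomposes as e + d with e idempotent and d in
  \<open>Delta R\<close>, then e = u - d is an idempotent unit, which forces e = 1 and u = 1 + d.
  The reverse inclusion holds in every ring, since -1 is a unit and 1 + d = 1 - d(-1). The first
  half rests on \<open>Units_minus_Delta\<close> and \<open>idem_Units_eq_one\<close>, the second on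
  \<open>one_plus_Delta_Units\<close>.\<close>

context ring
begin

text \<open>Factoring u out on the right leaves 1 - d u^-1, a unit by the definition of
  \<open>Delta\<close> applied to the unit \<open>inv u\<close>.\<close>

lemma Units_minus_Delta:
  assumes u: "u \<in> Units R" and d: "d \<in> Delta R"
  shows "u \<ominus> d \<in> Units R"
proof -
  have dc: "d \<in> carrier R" and uc: "u \<in> carrier R" and ic: "inv u \<in> carrier R"
    using u d by (auto simp: Delta_def)
  have "\<one> \<ominus> d \<otimes> inv u \<in> Units R"
    using u d by (simp add: Delta_def)
  then have "(\<one> \<ominus> d \<otimes> inv u) \<otimes> u \<in> Units R"
    using u by simp
  moreover have "(\<one> \<ominus> d \<otimes> inv u) \<otimes> u = u \<ominus> d"
    using dc uc ic u by (simp add: minus_eq l_distr l_minus m_assoc)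
  ultimately show ?thesis by simp
qed

text \<open>This is the defining condition of \<open>Delta\<close> tested at the unit -1.\<close>

lemma one_plus_Delta_Units:
  assumes d: "d \<in> Delta R"
  shows "\<one> \<oplus> d \<in> Units R"
proof -
  have dc: "d \<in> carrier R"
    using d by (simp add: Delta_def)
  have "\<ominus> \<one> \<in> Units R"
    by (rule Units_minus_one_closed)
  then have "\<one> \<ominus> d \<otimes> (\<ominus> \<one>) \<in> Units R"
    using d by (simp add: Delta_def)
  then show ?thesis
    using dc by (simp add: minus_eq r_minus)
qed

lemma idem_Units_eq_one:
  assumes "e \<in> Units R" and "e \<otimes> e = e"
  shows "e = \<one>"
  using assms by (metis Units_closed Units_l_cancel one_closed r_one)

end

theorem lemma2p17:
  fixes R :: "('a, 'b) ring_scheme"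
  assumes "strongly_Delta_clean_ring R"
  shows "Delta_U_ring R"
proof -
  interpret strongly_Delta_clean_ring R by (rule assms)
  show ?thesis
  proof
    show "(\<lambda>d. \<one>\<^bsub>R\<^esub> \<oplus>\<^bsub>R\<^esub> d) ` Delta R = Units R"
    proof
      show "(\<lambda>d. \<one>\<^bsub>R\<^esub> \<oplus>\<^bsub>R\<^esub> d) ` Delta R \<subseteq> Units R"
        using one_plus_Delta_Units by blast
      show "Units R \<subseteq> (\<lambda>d. \<one>\<^bsub>R\<^esub> \<oplus>\<^bsub>R\<^esub> d) ` Delta R"
      proof
        fix u assume u: "u \<in> Units R"
        then obtain e d where e: "e \<in> carrier R" "e \<otimes>\<^bsub>R\<^esub> e = e"
          and d: "d \<in> Delta R" and eq: "u = e \<oplus>\<^bsub>R\<^esub> d"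
          using strongly_Delta_clean Units_closed by blast
        have "d \<in> carrier R"
          using d by (simp add: Delta_def)
        \<comment> \<open>This exhibits the idempotent part as a unit minus an element of
          \<open>Delta R\<close>, hence as a unit.\<close>
        then have "u \<ominus>\<^bsub>R\<^esub> d = e"
          using e eq by (simp add: minus_eq a_assoc r_neg)
        then have "e = \<one>\<^bsub>R\<^esub>"
          using Units_minus_Delta[OF u d] e idem_Units_eq_one by simp
        then show "u \<in> (\<lambda>d. \<one>\<^bsub>R\<^esub> \<oplus>\<^bsub>R\<^esub> d) ` Delta R"
          using d eq by blast
      qed
    qed
  qed
qed

end
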